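(* For any tree $T$ of even order $n$, $m(T)\ge 1$, with equality if and only if $T$ has a perfect matching. For any tree $T$ of odd order $n>1$, $m(T)\ge 2$, with equality if and only if $T$ is obtained from a tree $T'$ of order $n-1$ with a perfect matching by doubling one of the leaves, i.e., by choosing a leaf $v$ of $T'$ and attaching a second leaf (a new vertex of degree $1$) to the unique neighbour of $v$.
   Context: For a finite graph $G$, $m(G)$ denotes the number of maximum matchings of $G$, i.e., the number of matchings of $G$ of largest possible cardinality. The order of a tree is its number of vertices. A leaf is a vertex of degree $1$. *)

theory Defs
  imports Main
begin

text \<open>A finite simple graph is given by its vertex set \<open>V\<close> and its edge set \<open>E\<close>, each edge being
  the two-element set of its end vertices.\<close>

definition simple_graph :: "'a set \<Rightarrow> 'a set set \<Rightarrow> bool" where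
  "simple_graph V E \<longleftrightarrow> finite V \<and> (\<forall>e\<in>E. \<exists>u\<in>V. \<exists>v\<in>V. u \<noteq> v \<and> e = {u, v})"

definition adj_rel :: "'a set set \<Rightarrow> ('a \<times> 'a) set" where
  "adj_rel E = {(u, v). {u, v} \<in> E}"

definition graph_connected :: "'a set \<Rightarrow> 'a set set \<Rightarrow> bool" where
  "graph_connected V E \<longleftrightarrow> V \<noteq> {} \<and> (\<forall>u\<in>V. \<forall>v\<in>V. (u, v) \<in> (adj_rel E)\<^sup>*)"

text \<open>A cycle is the list of its vertices, without repetition of the first one at the end.\<close>

definition graph_cycle :: "'a set set \<Rightarrow> 'a list \<Rightarrow> bool" where
  "graph_cycle E c \<longleftrightarrow> 3 \<le> length c \<and> distinct c \<and>
     (\<forall>i<length c. {c ! i, c ! (Suc i mod length c)} \<in> E)"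

definition tree_graph :: "'a set \<Rightarrow> 'a set set \<Rightarrow> bool" where
  "tree_graph V E \<longleftrightarrow> simple_graph V E \<and> graph_connected V E \<and> (\<nexists>c. graph_cycle E c)"

definition degree :: "'a set set \<Rightarrow> 'a \<Rightarrow> nat" where
  "degree E v = card {e \<in> E. v \<in> e}"

definition leaf :: "'a set \<Rightarrow> 'a set set \<Rightarrow> 'a \<Rightarrow> bool" where
  "leaf V E v \<longleftrightarrow> v \<in> V \<and> degree E v = 1"

definition matching :: "'a set set \<Rightarrow> 'a set set \<Rightarrow> bool" where
  "matching E M \<longleftrightarrow> M \<subseteq> E \<and> pairwise disjnt M"

definition maximum_matching :: "'a set set \<Rightarrow> 'a set set \<Rightarrow> bool" where
  "maximum_matching E M \<longleftrightarrow> matching E M \<and> (\<forall>M'. matching E M' \<longrightarrow> card M' \<le> card M)"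

definition num_max_matchings :: "'a set set \<Rightarrow> nat" where
  "num_max_matchings E = card {M. maximum_matching E M}"

definition perfect_matching :: "'a set \<Rightarrow> 'a set set \<Rightarrow> 'a set set \<Rightarrow> bool" where
  "perfect_matching V E M \<longleftrightarrow> matching E M \<and> \<Union>M = V"

text \<open>\<open>(V, E)\<close> arises from \<open>(V', E')\<close> by attaching a new vertex \<open>w\<close> to the neighbour \<open>u\<close> of the
  leaf \<open>v\<close>; since \<open>v\<close> has degree one, \<open>u\<close> is determined by \<open>v\<close>.\<close>

definition leaf_doubling ::
  "'a set \<Rightarrow> 'a set set \<Rightarrow> 'a \<Rightarrow> 'a set \<Rightarrow> 'a set set \<Rightarrow> bool" where
  "leaf_doubling V' E' v V E \<longleftrightarrow> leaf V' E' v \<and>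
     (\<exists>u w. {u, v} \<in> E' \<and> w \<notin> V' \<and> V = insert w V' \<and> E = insert {u, w} E')"

end

(* Let M be a maximum matching missing a vertex x, and let y be a neighbour of x. Then y is matched
   to some z, and replacing yz by xy gives another maximum matching whose only edge outside M is xy.
   So a tree of order at least 2 without a perfect matching has at least two maximum matchings, and
   if it has exactly two, then every maximum matching misses only one vertex x, which is a leaf.
   Applying this to the swapped matching, z is a leaf with neighbour y as well, and deleting x leaves
   a tree with perfect matching M whose leaf z has been doubled.  Conversely, perfect matchings of
   trees are unique, since a nonempty symmetric difference of two of them has minimum degree 2 and
   so contains a cycle; and after doubling a leaf, every maximum matching is perfect on one of the
   two trees that remain when one of the twin leaves is deleted. *)

theory Submission
  imports Defs
begin

section \<open>Cycles in graphs of minimum degree two\<close>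

lemma simple_graph_subset: "simple_graph V E \<Longrightarrow> F \<subseteq> E \<Longrightarrow> simple_graph V F"
  unfolding simple_graph_def by blast

lemma simple_graph_finite_edges:
  assumes "simple_graph V E"
  shows "finite E"
proof (rule finite_subset)
  show "E \<subseteq> Pow V" using assms unfolding simple_graph_def by auto
  show "finite (Pow V)" using assms unfolding simple_graph_def by simp
qed

lemma simple_graph_edge_at:
  assumes "simple_graph V E" "e \<in> E" "x \<in> e"
  obtains y where "e = {x, y}" "x \<noteq> y" "x \<in> V" "y \<in> V"
  using assms unfolding simple_graph_def by (metis insertE insert_commute singletonD)

lemma graph_cycle_mono: "graph_cycle E c \<Longrightarrow> E \<subseteq> F \<Longrightarrow> graph_cycle F c"
  unfolding graph_cycle_def by blast

text \<open>A second edge at the first vertex of a longest path must lead back to the path, and so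
  closes a cycle. Vertices of \<open>V\<close> that meet no edge of \<open>D\<close> are allowed, as
  happens for a symmetric difference.\<close>

lemma min_degree_two_cycle:
  assumes G: "simple_graph V D" and ne: "D \<noteq> {}"
    and deg: "\<And>e x. e \<in> D \<Longrightarrow> x \<in> e \<Longrightarrow> \<exists>f\<in>D. x \<in> f \<and> f \<noteq> e"
  shows "\<exists>c. graph_cycle D c"
proof -
  \<comment> \<open>Paths of \<open>D\<close> with at least one edge, as vertex lists; the length
    bound makes \<open>p ! 0\<close> and \<open>p ! 1\<close> available.\<close>
  define P where "P p \<longleftrightarrow> 2 \<le> length p \<and> distinct p \<and> set p \<subseteq> V \<and>
    (\<forall>i. Suc i < length p \<longrightarrow> {p ! i, p ! Suc i} \<in> D)" for p
  have fin: "finite V" using G by (simp add: simple_graph_def)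
  obtain e where "e \<in> D" using ne by blast
  then obtain u v where uv: "u \<in> V" "v \<in> V" "u \<noteq> v" "{u, v} \<in> D"
    using G unfolding simple_graph_def by metis
  have "P [u, v]" using uv by (auto simp: P_def)
  moreover have "length p < Suc (card V)" if "P p" for p
    using that fin card_mono[of V "set p"] by (auto simp: P_def distinct_card)
  ultimately obtain p where p: "P p" and pmax: "\<And>q. P q \<Longrightarrow> length q \<le> length p"
    using ex_has_greatest_nat[of P "[u, v]" length "Suc (card V)"] by auto
  have len: "2 \<le> length p" and dist: "distinct p" and pV: "set p \<subseteq> V"
    and pE: "\<And>i. Suc i < length p \<Longrightarrow> {p ! i, p ! Suc i} \<in> D"
    using p by (auto simp: P_def)
  have "{p ! 0, p ! 1} \<in> D" using pE[of 0] len by simp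
  \<comment> \<open>A second edge at the start of the path, besides its first edge.\<close>
  then obtain f where f: "f \<in> D" "p ! 0 \<in> f" "f \<noteq> {p ! 0, p ! 1}"
    using deg[of "{p ! 0, p ! 1}" "p ! 0"] by auto
  obtain y where y: "f = {p ! 0, y}" "p ! 0 \<noteq> y" "y \<in> V"
    using simple_graph_edge_at[OF G f(1,2)] by metis
  \<comment> \<open>Otherwise prepending \<open>y\<close> would give a longer path.\<close>
  have "y \<in> set p"
  proof (rule ccontr)
    assume "y \<notin> set p"
    then have "P (y # p)"
      using len dist pV pE y f(1) by (auto simp: P_def nth_Cons insert_commute split: nat.splits)
    then show False using pmax by fastforce
  qed
  then obtain k where k: "k < length p" "p ! k = y" by (auto simp: in_set_conv_nth)
  \<comment> \<open>\<open>k = 0\<close> would make \<open>f\<close> a loop and \<open>k = 1\<close>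
    would make it the first edge of the path; so the cycle has at least three vertices.\<close>
  have "k \<noteq> 0" using k(2) y(2) by metis
  moreover have "k \<noteq> 1" using k(2) y(1) f(3) by metis
  ultimately have k2: "2 \<le> k" by linarith
  have "graph_cycle D (take (Suc k) p)"
    unfolding graph_cycle_def
  proof (intro conjI allI impI)
    show "3 \<le> length (take (Suc k) p)" using k k2 by auto
    show "distinct (take (Suc k) p)" using dist by simp
    fix i assume i: "i < length (take (Suc k) p)"
    show "{take (Suc k) p ! i, take (Suc k) p ! (Suc i mod length (take (Suc k) p))} \<in> D"
    \<comment> \<open>At \<open>i = k\<close> the index wraps to 0 and the edge is \<open>f\<close>;
      all other edges come from the path.\<close>
    proof (cases "i = k")
      case True
      moreover have "length (take (Suc k) p) = Suc k" using k by simp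
      ultimately show ?thesis using k y(1) f(1) by (simp add: insert_commute)
    next
      case False
      then show ?thesis using k i pE[of i] by (simp add: min_def split: if_splits)
    qed
  qed
  then show ?thesis by blast
qed

section \<open>Matchings: covered vertices and cardinality bounds\<close>

lemma matching_edge_unique:
  "matching E M \<Longrightarrow> e \<in> M \<Longrightarrow> f \<in> M \<Longrightarrow> x \<in> e \<Longrightarrow> x \<in> f \<Longrightarrow> e = f"
  unfolding matching_def pairwise_def disjnt_def by blast

lemma matching_mono: "matching E M \<Longrightarrow> E \<subseteq> F \<Longrightarrow> matching F M"
  unfolding matching_def by blast

lemma matching_Diff: "matching E M \<Longrightarrow> matching E (M - N)"
  unfolding matching_def pairwise_def by blast

lemma matching_insert:
  "matching E M \<Longrightarrow> e \<in> E \<Longrightarrow> e \<inter> \<Union>M = {} \<Longrightarrow> matching E (insert e M)"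
  unfolding matching_def pairwise_insert disjnt_def by blast

lemma matching_finite: "simple_graph V E \<Longrightarrow> matching E M \<Longrightarrow> finite M"
  unfolding matching_def using simple_graph_finite_edges finite_subset by blast

lemma matching_Union_subset:
  assumes "simple_graph V E" "matching E M"
  shows "\<Union>M \<subseteq> V"
proof -
  have "e \<subseteq> V" if "e \<in> E" for e using assms(1) that unfolding simple_graph_def by fastforce
  then show ?thesis using assms(2) by (auto simp: matching_def)
qed

text \<open>Turns comparisons of matching sizes into counts of covered vertices, and supplies the
  parity argument for odd order.\<close>

lemma card_Union_matching:
  assumes "simple_graph V E" "matching E M"
  shows "card (\<Union>M) = 2 * card M"
proof -
  have two: "card e = 2 \<and> finite e" if "e \<in> M" for e
  proof -
    have "e \<in> E" using that assms unfolding matching_def by blast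
    then obtain u v where "u \<noteq> v" "e = {u, v}" using assms unfolding simple_graph_def by metis
    then show ?thesis by simp
  qed
  have "card (\<Union>M) = sum card M"
    using assms(2) two by (intro card_Union_disjoint) (auto simp: matching_def)
  also have "\<dots> = 2 * card M" using two by simp
  finally show ?thesis .
qed

lemma matching_card_le:
  "simple_graph V E \<Longrightarrow> matching E M \<Longrightarrow> 2 * card M \<le> card V"
  using card_Union_matching matching_Union_subset card_mono
  unfolding simple_graph_def by metis

lemma maximum_matching_exists:
  assumes "simple_graph V E"
  shows "\<exists>M. maximum_matching E M"
proof -
  have "matching E {}" by (simp add: matching_def)
  moreover have "\<forall>M. matching E M \<longrightarrow> card M < Suc (card V)"
    using matching_card_le[OF assms] by fastforce
  ultimately show ?thesis
    using ex_has_greatest_nat[of "matching E" "{}" card "Suc (card V)"]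
    unfolding maximum_matching_def by blast
qed

lemma finite_maximum_matchings:
  assumes "simple_graph V E"
  shows "finite {M. maximum_matching E M}"
proof (rule finite_subset)
  show "{M. maximum_matching E M} \<subseteq> Pow E" by (auto simp: maximum_matching_def matching_def)
  show "finite (Pow E)" using simple_graph_finite_edges[OF assms] by simp
qed

section \<open>Uniqueness of perfect matchings in trees\<close>

lemma perfect_matching_unique:
  assumes T: "tree_graph V E" and "perfect_matching V E M" "perfect_matching V E N"
  shows "M = N"
proof (rule ccontr)
  assume neq: "M \<noteq> N"
  let ?D = "(M - N) \<union> (N - M)"
  have M: "matching E M" "\<Union>M = V" and N: "matching E N" "\<Union>N = V"
    using assms by (auto simp: perfect_matching_def)
  have G: "simple_graph V E" and acyc: "\<nexists>c. graph_cycle E c"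
    using T by (auto simp: tree_graph_def)
  have sub: "?D \<subseteq> E" using M N by (auto simp: matching_def)
  \<comment> \<open>At \<open>x\<close> each matching has exactly one edge, \<open>f\<close> and
    \<open>g\<close>. As \<open>e\<close> lies in only one of the matchings, it is one of these two
    edges, and the other one lies in \<open>?D\<close> as well.\<close>
  have "\<exists>f\<in>?D. x \<in> f \<and> f \<noteq> e" if e: "e \<in> ?D" "x \<in> e" for e x
  proof -
    have "x \<in> \<Union>M" "x \<in> \<Union>N" using e M N by auto
    then obtain f g where fg: "f \<in> M" "x \<in> f" "g \<in> N" "x \<in> g" by blast
    have "h = f" if "h \<in> M" "x \<in> h" for h
      using matching_edge_unique[OF M(1) that(1) fg(1) that(2) fg(2)] .
    moreover have "h = g" if "h \<in> N" "x \<in> h" for h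
      using matching_edge_unique[OF N(1) that(1) fg(3) that(2) fg(4)] .
    ultimately show ?thesis using e fg by (cases "e \<in> M") auto
  qed
  then have "\<exists>c. graph_cycle ?D c"
    using neq by (intro min_degree_two_cycle[OF simple_graph_subset[OF G sub]]) auto
  then show False using acyc graph_cycle_mono sub by blast
qed

section \<open>Exchanging an edge at a missed vertex\<close>

lemma maximum_matching_swap:
  assumes G: "simple_graph V E" and M: "maximum_matching E M"
    and xy: "{x, y} \<in> E" and x: "x \<notin> \<Union>M"
  obtains z where "{y, z} \<in> M" "z \<noteq> y" "maximum_matching E (insert {x, y} (M - {{y, z}}))"
proof -
  have mM: "matching E M" and max: "\<And>M'. matching E M' \<Longrightarrow> card M' \<le> card M"
    using M by (auto simp: maximum_matching_def)
  have fin: "finite M" using matching_finite[OF G mM] .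
  have xyM: "{x, y} \<notin> M" using x by blast
  have "y \<in> \<Union>M"
  proof (rule ccontr)
    assume "y \<notin> \<Union>M"
    then have "matching E (insert {x, y} M)" using x xy by (intro matching_insert[OF mM]) auto
    then show False using max fin xyM by fastforce
  qed
  then obtain e where e: "e \<in> M" "y \<in> e" by blast
  have "e \<in> E" using e mM by (auto simp: matching_def)
  then obtain z where z: "e = {y, z}" "z \<noteq> y"
    using simple_graph_edge_at[OF G _ e(2)] by metis
  let ?N = "insert {x, y} (M - {{y, z}})"
  \<comment> \<open>The removed edge was the only one of \<open>M\<close> at \<open>y\<close>, so
    both ends of \<open>{x, y}\<close> are now free.\<close>
  have "y \<notin> \<Union>(M - {{y, z}})" using matching_edge_unique[OF mM e(1) _ e(2)] z by blast
  then have "matching E ?N" using x xy by (intro matching_insert matching_Diff[OF mM]) auto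
  moreover have "card ?N = card M"
    using xyM fin e(1) z(1) card_Suc_Diff1[OF fin] by (simp del: card_Diff_insert)
  ultimately have "maximum_matching E ?N" using max by (simp add: maximum_matching_def)
  then show ?thesis using that z e by blast
qed

lemma tree_graph_edge_at:
  assumes "tree_graph V E" "card V > 1" "x \<in> V"
  obtains y where "{x, y} \<in> E"
proof -
  have "V \<noteq> {x}" using assms by auto
  then obtain v where "v \<in> V" "v \<noteq> x" using assms(3) by blast
  then have "(x, v) \<in> (adj_rel E)\<^sup>*" "x \<noteq> v"
    using assms by (auto simp: tree_graph_def graph_connected_def)
  then obtain y where "(x, y) \<in> adj_rel E" by (meson converse_rtranclE)
  then show ?thesis using that by (auto simp: adj_rel_def)
qed

text \<open>Serves both parities: in even order it shows that a unique maximum matching is perfect,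
  in odd order it is the lower bound.\<close>

lemma num_max_matchings_ge_2:
  assumes T: "tree_graph V E" and n: "card V > 1" and np: "\<nexists>M. perfect_matching V E M"
  shows "num_max_matchings E \<ge> 2"
proof -
  have G: "simple_graph V E" using T by (simp add: tree_graph_def)
  obtain M where M: "maximum_matching E M" using maximum_matching_exists[OF G] by blast
  then have mM: "matching E M" by (simp add: maximum_matching_def)
  then have "\<Union>M \<noteq> V" using np by (auto simp: perfect_matching_def)
  then obtain x where x: "x \<in> V" "x \<notin> \<Union>M" using matching_Union_subset[OF G mM] by blast
  obtain y where y: "{x, y} \<in> E" using tree_graph_edge_at[OF T n x(1)] .
  obtain z where z: "maximum_matching E (insert {x, y} (M - {{y, z}}))" (is "maximum_matching E ?N")
    using maximum_matching_swap[OF G M y x(2)] by metis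
  have "M \<noteq> ?N" using x by blast
  then have "card {M, ?N} = 2" by simp
  moreover have "card {M, ?N} \<le> num_max_matchings E"
    unfolding num_max_matchings_def using M z finite_maximum_matchings[OF G]
    by (intro card_mono) auto
  ultimately show ?thesis by linarith
qed

text \<open>Any maximum matching is as large as the perfect one, hence covers all of
  \<open>V\<close>, and uniqueness of perfect matchings applies.\<close>

lemma num_max_matchings_perfect:
  assumes T: "tree_graph V E" and M: "perfect_matching V E M"
  shows "num_max_matchings E = 1"
proof -
  have G: "simple_graph V E" using T by (simp add: tree_graph_def)
  have mM: "matching E M" and UM: "\<Union>M = V" using M by (auto simp: perfect_matching_def)
  have cM: "card V = 2 * card M" using card_Union_matching[OF G mM] UM by simp
  have "maximum_matching E N \<longleftrightarrow> N = M" for N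
  proof
    assume "N = M"
    then show "maximum_matching E N"
      using mM matching_card_le[OF G] cM by (auto simp: maximum_matching_def)
  next
    assume N: "maximum_matching E N"
    then have mN: "matching E N" and "card M \<le> card N" using mM by (auto simp: maximum_matching_def)
    then have "card (\<Union>N) \<ge> card V" using card_Union_matching[OF G mN] cM by simp
    then have "\<Union>N = V"
      using matching_Union_subset[OF G mN] G card_seteq by (metis simple_graph_def)
    then show "N = M"
      using perfect_matching_unique[OF T _ M] mN by (simp add: perfect_matching_def)
  qed
  then show ?thesis by (simp add: num_max_matchings_def)
qed

section \<open>Trees with exactly two maximum matchings\<close>

text \<open>Swapping in an edge with a missed end gives a maximum matching whose only edge outside
  \<open>M\<close> is that one. Two such edges would give, together with \<open>M\<close>, three
  maximum matchings.\<close>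

lemma two_max_matchings_missed_edge_unique:
  assumes G: "simple_graph V E" and two: "num_max_matchings E = 2" and M: "maximum_matching E M"
    and e: "e \<in> E" "\<not> e \<subseteq> \<Union>M" and f: "f \<in> E" "\<not> f \<subseteq> \<Union>M"
  shows "e = f"
proof (rule ccontr)
  assume "e \<noteq> f"
  have swap: "\<exists>N. maximum_matching E N \<and> N - M = {e}" if e: "e \<in> E" "\<not> e \<subseteq> \<Union>M" for e
  proof -
    obtain x where x: "x \<in> e" "x \<notin> \<Union>M" using e by blast
    obtain y where y: "e = {x, y}" using simple_graph_edge_at[OF G e(1) x(1)] by metis
    obtain z where "maximum_matching E (insert {x, y} (M - {{y, z}}))"
      using maximum_matching_swap[OF G M _ x(2)] e y by metis
    moreover have "insert {x, y} (M - {{y, z}}) - M = {e}" using x y by blast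
    ultimately show ?thesis by blast
  qed
  obtain N1 where N1: "maximum_matching E N1" "N1 - M = {e}" using swap[OF e] by blast
  obtain N2 where N2: "maximum_matching E N2" "N2 - M = {f}" using swap[OF f] by blast
  have "M \<noteq> N1" "M \<noteq> N2" "N1 \<noteq> N2" using N1 N2 \<open>e \<noteq> f\<close> by auto
  then have "card {M, N1, N2} = 3" by simp
  moreover have "card {M, N1, N2} \<le> num_max_matchings E"
    unfolding num_max_matchings_def using M N1 N2 finite_maximum_matchings[OF G]
    by (intro card_mono) auto
  ultimately show False using two by simp
qed

text \<open>Stated for an arbitrary maximum matching, so that it applies to the swapped one
  too.\<close>

lemma two_max_matchings_missed_vertex:
  assumes T: "tree_graph V E" and n: "card V > 1" and two: "num_max_matchings E = 2"
    and M: "maximum_matching E M" and x: "x \<in> V" "x \<notin> \<Union>M" and xy: "{x, y} \<in> E"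
  shows "\<Union>M = V - {x}" "{e \<in> E. x \<in> e} = {{x, y}}"
proof -
  have G: "simple_graph V E" using T by (simp add: tree_graph_def)
  have mM: "matching E M" using M by (simp add: maximum_matching_def)
  note uniq = two_max_matchings_missed_edge_unique[OF G two M]
  show "{e \<in> E. x \<in> e} = {{x, y}}" using uniq xy x by blast
  have "w = x" if w: "w \<in> V" "w \<notin> \<Union>M" for w
  proof (rule ccontr)
    assume "w \<noteq> x"
    obtain u where u: "{w, u} \<in> E" using tree_graph_edge_at[OF T n w(1)] .
    \<comment> \<open>Both edges have a missed end, so they coincide. This forces
      \<open>w = y\<close>, but \<open>y\<close> is covered, since the swap finds an edge of
      \<open>M\<close> at it.\<close>
    have "{w, u} = {x, y}" using uniq u xy x w by blast
    then have "y = w" using \<open>w \<noteq> x\<close> by (auto simp: doubleton_eq_iff)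
    then show False using maximum_matching_swap[OF G M xy x(2)] w by blast
  qed
  then show "\<Union>M = V - {x}" using matching_Union_subset[OF G mM] x by blast
qed

text \<open>Connectedness survives because a walk through \<open>x\<close> enters and leaves by
  \<open>y\<close>: it may wait at \<open>y\<close> instead.\<close>

lemma tree_graph_delete_leaf:
  assumes T: "tree_graph V E" and ne: "V \<noteq> {x}" and x: "{e \<in> E. x \<in> e} = {{x, y}}"
  shows "tree_graph (V - {x}) (E - {{x, y}})"
proof -
  let ?E = "E - {{x, y}}"
  have G: "simple_graph V E" and conn: "graph_connected V E" and acyc: "\<nexists>c. graph_cycle E c"
    using T by (auto simp: tree_graph_def)
  have at_x: "b = y" if "{x, b} \<in> E" for b
  proof -
    have "{x, b} \<in> {e \<in> E. x \<in> e}" using that by simp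
    then have "{x, b} = {x, y}" unfolding x by simp
    then show ?thesis by (auto simp: doubleton_eq_iff)
  qed
  have "{x, y} \<in> E" using x by blast
  then have "y \<noteq> x" using G by (auto simp: simple_graph_def doubleton_eq_iff)
  have notin: "x \<notin> e" if "e \<in> ?E" for e using that x by blast
  have "simple_graph (V - {x}) ?E"
    unfolding simple_graph_def
  proof (intro conjI ballI)
    show "finite (V - {x})" using G by (simp add: simple_graph_def)
    fix e assume e: "e \<in> ?E"
    then obtain u v where "u \<in> V" "v \<in> V" "u \<noteq> v" "e = {u, v}"
      using G unfolding simple_graph_def by blast
    then show "\<exists>u\<in>V - {x}. \<exists>v\<in>V - {x}. u \<noteq> v \<and> e = {u, v}" using notin[OF e] by blast
  qed
  moreover have "graph_connected (V - {x}) ?E"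
    unfolding graph_connected_def
  proof (intro conjI ballI)
    show "V - {x} \<noteq> {}" using ne conn by (auto simp: graph_connected_def)
    fix u v assume u: "u \<in> V - {x}" and v: "v \<in> V - {x}"
    \<comment> \<open>The invariant projects \<open>x\<close> onto its only neighbour
      \<open>y\<close>. Steps into or out of \<open>x\<close> become stationary, and every other
      edge survives the deletion.\<close>
    have "(u, if a = x then y else a) \<in> (adj_rel ?E)\<^sup>*" if "(u, a) \<in> (adj_rel E)\<^sup>*" for a
      using that
    proof (induction rule: rtrancl_induct)
      case base
      then show ?case using u by simp
    next
      case (step a b)
      have ab: "{a, b} \<in> E" using step by (simp add: adj_rel_def)
      consider "a = x" | "a \<noteq> x" "b = x" | "a \<noteq> x" "b \<noteq> x" by blast
      then show ?case
      proof cases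
        case 1
        then show ?thesis using step.IH at_x[of b] ab \<open>y \<noteq> x\<close> by simp
      next
        case 2
        then show ?thesis using step.IH at_x[of a] ab by (simp add: insert_commute)
      next
        case 3
        then have "(a, b) \<in> adj_rel ?E" using ab by (auto simp: adj_rel_def doubleton_eq_iff)
        then show ?thesis using step.IH 3 by (simp add: rtrancl.rtrancl_into_rtrancl)
      qed
    qed
    from this[of v] show "(u, v) \<in> (adj_rel ?E)\<^sup>*"
      using u v conn by (simp add: graph_connected_def)
  qed
  moreover have "\<nexists>c. graph_cycle ?E c" using acyc graph_cycle_mono by blast
  ultimately show ?thesis by (simp add: tree_graph_def)
qed

lemma two_max_matchings_imp_leaf_doubling:
  assumes T: "tree_graph V E" and odd: "odd (card V)" and n: "card V > 1"
    and two: "num_max_matchings E = 2"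
  shows "\<exists>V' E' v. tree_graph V' E' \<and> card V' = card V - 1 \<and>
    (\<exists>M. perfect_matching V' E' M) \<and> leaf_doubling V' E' v V E"
proof -
  have G: "simple_graph V E" using T by (simp add: tree_graph_def)
  obtain M where M: "maximum_matching E M" using maximum_matching_exists[OF G] by blast
  then have mM: "matching E M" by (simp add: maximum_matching_def)
  \<comment> \<open>A matching covers an even number of vertices.\<close>
  have "\<Union>M \<noteq> V" using card_Union_matching[OF G mM] odd by auto
  then obtain x where x: "x \<in> V" "x \<notin> \<Union>M" using matching_Union_subset[OF G mM] by blast
  obtain y where xy: "{x, y} \<in> E" using tree_graph_edge_at[OF T n x(1)] .
  obtain z where z: "{y, z} \<in> M" "z \<noteq> y"
    and N: "maximum_matching E (insert {x, y} (M - {{y, z}}))" (is "maximum_matching E ?N")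
    using maximum_matching_swap[OF G M xy x(2)] .
  note atx = two_max_matchings_missed_vertex[OF T n two M x xy]
  have zx: "z \<noteq> x" using z x by blast
  have zV: "z \<in> V" using z matching_Union_subset[OF G mM] by blast
  have yzE: "{z, y} \<in> E" using z mM by (auto simp: matching_def insert_commute)
  \<comment> \<open>The only edge of \<open>M\<close> at \<open>z\<close> was the removed
    \<open>{y, z}\<close>, and \<open>z\<close> differs from both \<open>x\<close> and
    \<open>y\<close>.\<close>
  have zN: "z \<notin> \<Union>?N" using matching_edge_unique[OF mM z(1), of _ z] z zx by blast
  \<comment> \<open>With the roles of \<open>x\<close> and \<open>z\<close> exchanged,
    \<open>{z, y}\<close> is the only edge at \<open>z\<close>: the two vertices are twin leaves at
    \<open>y\<close>.\<close>
  note atz = two_max_matchings_missed_vertex[OF T n two N zV zN yzE]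
  have "V \<noteq> {x}" using n by auto
  then have T': "tree_graph (V - {x}) (E - {{x, y}})"
    using tree_graph_delete_leaf[OF T _ atx(2)] by blast
  have "card (V - {x}) = card V - 1" using x by simp
  moreover have "perfect_matching (V - {x}) (E - {{x, y}}) M"
    using mM atx(1) x unfolding perfect_matching_def matching_def by blast
  moreover have "leaf_doubling (V - {x}) (E - {{x, y}}) z V E"
  proof -
    have "{e \<in> E - {{x, y}}. z \<in> e} = {{z, y}}"
      using atz(2) zx z by (auto simp: doubleton_eq_iff)
    then have "leaf (V - {x}) (E - {{x, y}}) z" using zV zx by (simp add: leaf_def degree_def)
    moreover have "{y, z} \<in> E - {{x, y}}" using yzE zx by (auto simp: doubleton_eq_iff insert_commute)
    moreover have "V = insert x (V - {x})" using x by blast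
    moreover have "E = insert {y, x} (E - {{x, y}})" using xy by (auto simp: insert_commute)
    ultimately show ?thesis unfolding leaf_doubling_def by blast
  qed
  ultimately show ?thesis using T' by blast
qed

section \<open>Matchings after doubling a leaf\<close>

text \<open>The only candidates are \<open>M\<close> and the matching obtained from it by exchanging
  \<open>{u, v}\<close> for \<open>{u, w}\<close>.\<close>

lemma leaf_doubling_num_max_matchings_le:
  assumes T': "tree_graph V' E'" and M: "perfect_matching V' E' M"
    and G: "simple_graph V E" and LD: "leaf_doubling V' E' v V E"
  shows "num_max_matchings E \<le> 2"
proof -
  have G': "simple_graph V' E'" using T' by (simp add: tree_graph_def)
  obtain u w where v: "v \<in> V'" "degree E' v = 1" and uv: "{u, v} \<in> E'" and w: "w \<notin> V'"
    and V: "V = insert w V'" and E: "E = insert {u, w} E'"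
    using LD by (auto simp: leaf_doubling_def leaf_def)
  have atv: "e = {u, v}" if "e \<in> E'" "v \<in> e" for e
  proof -
    obtain e0 where e0: "{e \<in> E'. v \<in> e} = {e0}"
      using v(2) unfolding degree_def by (auto simp: card_1_singleton_iff)
    have "e \<in> {e \<in> E'. v \<in> e}" "{u, v} \<in> {e \<in> E'. v \<in> e}" using that uv by auto
    then show ?thesis unfolding e0 by simp
  qed
  have mM: "matching E' M" and UM: "\<Union>M = V'" using M by (auto simp: perfect_matching_def)
  have finV': "finite V'" using G' by (simp add: simple_graph_def)
  have cM: "card V' = 2 * card M" using card_Union_matching[OF G' mM] UM by simp
  have uvM: "{u, v} \<in> M"
  proof -
    obtain e where "e \<in> M" "v \<in> e" using UM v by blast
    then show ?thesis using atv[of e] mM by (auto simp: matching_def)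
  qed
  have "N = M \<or> N = insert {u, w} (M - {{u, v}})" if N: "maximum_matching E N" for N
  proof -
    have mN: "matching E N" using N by (simp add: maximum_matching_def)
    \<comment> \<open>\<open>M\<close> remains a matching of the larger graph, so \<open>N\<close>
      covers at least \<open>card V'\<close> vertices.\<close>
    have "matching E M" using matching_mono[OF mM] E by blast
    then have "card M \<le> card N" using N by (simp add: maximum_matching_def)
    then have cN: "card V' \<le> card (\<Union>N)" using card_Union_matching[OF G mN] cM by simp
    have NE: "N \<subseteq> E" using mN by (simp add: matching_def)
    show ?thesis
    proof (cases "{u, w} \<in> N")
      case False
      \<comment> \<open>Without the new edge, \<open>N\<close> lives in the old tree and covers all
        of it.\<close>
      then have "N \<subseteq> E'" using NE E by blast
      then have mN': "matching E' N" using mN by (simp add: matching_def)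
      then have "\<Union>N = V'" using matching_Union_subset[OF G' mN'] cN finV' card_seteq by metis
      then show ?thesis
        using perfect_matching_unique[OF T' _ M] mN' by (simp add: perfect_matching_def)
    next
      case True
      let ?N = "N - {{u, w}}"
      have uN: "u \<notin> \<Union>?N" using matching_edge_unique[OF mN True, of _ u] by blast
      have NE': "?N \<subseteq> E'" using NE E by blast
      \<comment> \<open>The edge \<open>{u, w}\<close> occupies \<open>u\<close>, and the only edge
        of \<open>E'\<close> at \<open>v\<close> is \<open>{u, v}\<close>; so \<open>v\<close> is
        free and \<open>{u, v}\<close> can replace \<open>{u, w}\<close>. The result is a matching
        of the old tree of the same size, hence perfect.\<close>
      have vN: "v \<notin> \<Union>?N" using atv NE' uN by blast
      have "matching E' ?N" using matching_Diff[OF mN] NE' by (simp add: matching_def)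
      then have mN': "matching E' (insert {u, v} ?N)"
        using uN vN uv by (intro matching_insert) auto
      have "finite N" using matching_finite[OF G mN] .
      moreover have "{u, v} \<notin> ?N" using uN by blast
      ultimately have "card (insert {u, v} ?N) = card N"
        using True card_Suc_Diff1 by (simp del: card_Diff_insert)
      then have "card V' \<le> card (\<Union>(insert {u, v} ?N))"
        using cN card_Union_matching[OF G mN] card_Union_matching[OF G' mN'] by simp
      then have "\<Union>(insert {u, v} ?N) = V'"
        using matching_Union_subset[OF G' mN'] finV' card_seteq by metis
      then have "insert {u, v} ?N = M"
        using perfect_matching_unique[OF T' _ M] mN' by (simp add: perfect_matching_def)
      \<comment> \<open>Undoing the exchange recovers \<open>N\<close> from
        \<open>M\<close>.\<close>
      then show ?thesis using True \<open>{u, v} \<notin> ?N\<close> by blast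
    qed
  qed
  then have "{N. maximum_matching E N} \<subseteq> {M, insert {u, w} (M - {{u, v}})}" by blast
  then have "num_max_matchings E \<le> card {M, insert {u, w} (M - {{u, v}})}"
    unfolding num_max_matchings_def by (intro card_mono) auto
  also have "\<dots> \<le> 2" by (simp add: card_insert_if)
  finally show ?thesis .
qed

theorem theorem1p1:
  fixes V :: "'a set" and E :: "'a set set"
  assumes "tree_graph V E"
  shows "(even (card V) \<longrightarrow>
            num_max_matchings E \<ge> 1 \<and>
            (num_max_matchings E = 1 \<longleftrightarrow> (\<exists>M. perfect_matching V E M))) \<and>
         (odd (card V) \<and> card V > 1 \<longrightarrow>
            num_max_matchings E \<ge> 2 \<and>
            (num_max_matchings E = 2 \<longleftrightarrow>
              (\<exists>V' E' v. tree_graph V' E' \<and> card V' = card V - 1 \<and>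
                 (\<exists>M. perfect_matching V' E' M) \<and> leaf_doubling V' E' v V E)))"
proof (intro conjI impI)
  have G: "simple_graph V E" using assms by (simp add: tree_graph_def)
  have pos: "card V > 0"
    using assms by (auto simp: tree_graph_def graph_connected_def simple_graph_def card_gt_0_iff)
  {
    assume "even (card V)"
    \<comment> \<open>A tree is nonempty, so an even order is at least 2.\<close>
    then have n: "card V > 1" using pos by (cases "card V = 1") auto
    show "num_max_matchings E = 1 \<longleftrightarrow> (\<exists>M. perfect_matching V E M)"
      using num_max_matchings_ge_2[OF assms n] num_max_matchings_perfect[OF assms] by fastforce
    then show "num_max_matchings E \<ge> 1"
      using num_max_matchings_ge_2[OF assms n] by fastforce
  }
  assume odd: "odd (card V) \<and> card V > 1"
  have "\<nexists>M. perfect_matching V E M"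
    using odd card_Union_matching[OF G] unfolding perfect_matching_def by fastforce
  then show ge: "num_max_matchings E \<ge> 2" using num_max_matchings_ge_2 assms odd by blast
  show "num_max_matchings E = 2 \<longleftrightarrow>
      (\<exists>V' E' v. tree_graph V' E' \<and> card V' = card V - 1 \<and>
         (\<exists>M. perfect_matching V' E' M) \<and> leaf_doubling V' E' v V E)"
    using two_max_matchings_imp_leaf_doubling[OF assms] odd ge
      leaf_doubling_num_max_matchings_le[OF _ _ G] le_antisym by metis
qed

end
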